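(* There is a polynomial time algorithm for the following problem. The input consists of vectors $e_1,\ldots,e_n \in \mathbb{R}^2$ which are non-zero and pairwise non-parallel, and vectors $\tau_1,\ldots,\tau_n \in \mathbb{R}^2$ which are likewise non-zero and pairwise non-parallel. In time polynomial in $n$, the algorithm either finds a set of indices $J \subseteq [n] = \{1,2,\ldots,n\}$ such that the group $$ \mathrm{span}_{\mathbb{Z}}\{\tau_j,\ e_{j'} : \ j \in J,\ j' \in [n]\setminus J\} $$ is discrete, or decides that no such $J$ exists.
   Context: For a set $S \subseteq \mathbb{R}^2$, $\mathrm{span}_{\mathbb{Z}} S$ denotes the additive subgroup of $\mathbb{R}^2$ generated by $S$. "Discrete" means discrete as an additive subgroup of $\mathbb{R}^2$ with the usual topology (the subgroup is not required to have rank $2$). Computational model: the algorithm operates on arbitrary real numbers. Arithmetic operations on real numbers (together with the usual comparisons) take constant time, and it can be decided in constant time whether a given real number is rational. *)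

theory Defs
  imports "HOL-Analysis.Analysis" "HOL-Computational_Algebra.Computational_Algebra"
begin

section \<open>A real RAM with a rationality test\<close>

text \<open>
  Programs are structured (while) programs over a random access machine with two sorts of data.
  Index registers hold natural numbers and serve for counting and addressing; real registers and
  the unbounded real memory hold arbitrary real numbers. Every elementary instruction and every
  test costs one time unit.

  As usual for real RAMs, there is no instruction turning a real into an index (no rounding), and
  the only real constants are integers, so that a program is a finite discrete object.
\<close>

type_synonym reg = nat

datatype aop = Add | Sub | Mul | Div

datatype test =
    ILess reg reg
  | IEq reg reg
  | RLess reg reg
  | REq reg reg
  | IsRat reg

datatype com =
    Skip
  | IConst reg nat
  | IAdd reg reg reg
  | ISub reg reg reg
  | RConst reg int
  | ROp aop reg reg reg
  | Load reg reg
  | Store reg reg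
  | Emit reg
  | Seq com com
  | Cond test com com
  | While test com

record state =
  ireg :: "reg \<Rightarrow> nat"
  rreg :: "reg \<Rightarrow> real"
  memory :: "nat \<Rightarrow> real"
  tape :: "nat list"

fun aop_val :: "aop \<Rightarrow> real \<Rightarrow> real \<Rightarrow> real" where
  "aop_val Add x y = x + y"
| "aop_val Sub x y = x - y"
| "aop_val Mul x y = x * y"
| "aop_val Div x y = x / y"

fun test_val :: "test \<Rightarrow> state \<Rightarrow> bool" where
  "test_val (ILess a b) s \<longleftrightarrow> ireg s a < ireg s b"
| "test_val (IEq a b) s \<longleftrightarrow> ireg s a = ireg s b"
| "test_val (RLess a b) s \<longleftrightarrow> rreg s a < rreg s b"
| "test_val (REq a b) s \<longleftrightarrow> rreg s a = rreg s b"
| "test_val (IsRat a) s \<longleftrightarrow> rreg s a \<in> \<rat>"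

text \<open>
  \<open>run c s t s'\<close>: started in state \<open>s\<close>, the program \<open>c\<close> halts after exactly \<open>t\<close> time units in
  state \<open>s'\<close>. In \<open>Load\<close> and \<open>Store\<close> the address is the content of an index register. Subtraction
  of indices is truncated at 0. A division by zero has no successor state: the machine gets stuck
  and hence does not halt.
\<close>

inductive run :: "com \<Rightarrow> state \<Rightarrow> nat \<Rightarrow> state \<Rightarrow> bool" where
  run_Skip: "run Skip s 1 s"
| run_IConst: "run (IConst d k) s 1 (s\<lparr>ireg := (ireg s)(d := k)\<rparr>)"
| run_IAdd: "run (IAdd d a b) s 1 (s\<lparr>ireg := (ireg s)(d := ireg s a + ireg s b)\<rparr>)"
| run_ISub: "run (ISub d a b) s 1 (s\<lparr>ireg := (ireg s)(d := ireg s a - ireg s b)\<rparr>)"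
| run_RConst: "run (RConst d k) s 1 (s\<lparr>rreg := (rreg s)(d := of_int k)\<rparr>)"
| run_ROp: "\<not> (f = Div \<and> rreg s b = 0) \<Longrightarrow>
    run (ROp f d a b) s 1 (s\<lparr>rreg := (rreg s)(d := aop_val f (rreg s a) (rreg s b))\<rparr>)"
| run_Load: "run (Load d a) s 1 (s\<lparr>rreg := (rreg s)(d := memory s (ireg s a))\<rparr>)"
| run_Store: "run (Store a b) s 1 (s\<lparr>memory := (memory s)(ireg s a := rreg s b)\<rparr>)"
| run_Emit: "run (Emit a) s 1 (s\<lparr>tape := tape s @ [ireg s a]\<rparr>)"
| run_Seq: "run c1 s1 t1 s2 \<Longrightarrow> run c2 s2 t2 s3 \<Longrightarrow> run (Seq c1 c2) s1 (t1 + t2) s3"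
| run_CondTrue: "test_val b s \<Longrightarrow> run c1 s t s' \<Longrightarrow> run (Cond b c1 c2) s (Suc t) s'"
| run_CondFalse: "\<not> test_val b s \<Longrightarrow> run c2 s t s' \<Longrightarrow> run (Cond b c1 c2) s (Suc t) s'"
| run_WhileFalse: "\<not> test_val b s \<Longrightarrow> run (While b c) s 1 s"
| run_WhileTrue: "test_val b s1 \<Longrightarrow> run c s1 t1 s2 \<Longrightarrow> run (While b c) s2 t2 s3 \<Longrightarrow>
    run (While b c) s1 (Suc (t1 + t2)) s3"

text \<open>The machine is deterministic, so halting time and final state are functions of the input.\<close>

inductive_cases run_elims:
  "run Skip s t s'" "run (IConst d k) s t s'" "run (IAdd d a b) s t s'" "run (ISub d a b) s t s'"
  "run (RConst d k) s t s'" "run (ROp f d a b) s t s'" "run (Load d a) s t s'"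
  "run (Store a b) s t s'" "run (Emit a) s t s'" "run (Seq c1 c2) s t s'"
  "run (Cond b c1 c2) s t s'"
inductive_cases run_WhileE: "run (While b c) s t s'"

lemma run_deterministic:
  "run c s t s' \<Longrightarrow> run c s u s'' \<Longrightarrow> u = t \<and> s'' = s'"
proof (induction arbitrary: u s'' rule: run.induct)
  case (run_Seq c1 s1 t1 s2 c2 t2 s3)
  from run_Seq.prems obtain v1 v2 r where "run c1 s1 v1 r" "run c2 r v2 s''" "u = v1 + v2"
    by (auto elim: run_elims)
  with run_Seq.IH show ?case by blast
next
  case (run_WhileTrue b s1 c t1 s2 t2 s3)
  from run_WhileTrue.prems run_WhileTrue.hyps(1) obtain v1 v2 r
    where "run c s1 v1 r" "run (While b c) r v2 s''" "u = Suc (v1 + v2)"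
    by (auto elim: run_WhileE)
  with run_WhileTrue.IH show ?case by blast
next
  case (run_WhileFalse b s c)
  then show ?case by (auto elim: run_WhileE)
next
  case (run_CondTrue b s c1 t s' c2)
  from run_CondTrue.prems run_CondTrue.hyps(1) obtain v where "run c1 s v s''" "u = Suc v"
    by (auto elim: run_elims)
  with run_CondTrue.IH show ?case by blast
next
  case (run_CondFalse b s c2 t s' c1)
  from run_CondFalse.prems run_CondFalse.hyps(1) obtain v where "run c2 s v s''" "u = Suc v"
    by (auto elim: run_elims)
  with run_CondFalse.IH show ?case by blast
qed (auto elim: run_elims)

text \<open>
  The size parameter \<open>n\<close> is supplied in index register 0, the real data in the initial memory cells.
\<close>

definition initial :: "nat \<Rightarrow> real list \<Rightarrow> state" where
  "initial n xs =
    \<lparr>ireg = (\<lambda>_. 0)(0 := n), rreg = (\<lambda>_. 0),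
     memory = (\<lambda>a. if a < length xs then xs ! a else 0), tape = []\<rparr>"


section \<open>The problem\<close>

definition coords :: "nat \<Rightarrow> (nat \<Rightarrow> real^2) \<Rightarrow> real list" where
  "coords n v = concat (map (\<lambda>j. [v j $ 1, v j $ 2]) [1..<Suc n])"

definition parallel :: "real^2 \<Rightarrow> real^2 \<Rightarrow> bool" where
  "parallel u v \<longleftrightarrow> collinear {0, u, v}"

definition mixed_span :: "(nat \<Rightarrow> real^2) \<Rightarrow> (nat \<Rightarrow> real^2) \<Rightarrow> nat \<Rightarrow> nat set \<Rightarrow> (real^2) set" where
  "mixed_span e \<tau> n J = group_closure (\<tau> ` J \<union> e ` ({1..n} - J))"

end

theory Submission
  imports Defs
begin

text \<open>
  Call a pair \<open>u\<close>, \<open>v\<close> of linearly independent vectors a witness if for every \<open>j\<close> at least one of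
  \<open>e j\<close>, \<open>\<tau> j\<close> is a rational combination of \<open>u\<close> and \<open>v\<close>. For \<open>n \<ge> 2\<close> a set \<open>J\<close> with discrete span
  exists iff some two of the \<open>2 * n\<close> given vectors form a witness.

  If \<open>u\<close>, \<open>v\<close> is a witness, put \<open>j\<close> into \<open>J\<close> exactly when \<open>e j\<close> is not a rational combination of
  \<open>u\<close> and \<open>v\<close>. All selected generators are then rational combinations, and clearing the finitely many
  denominators places their span inside the lattice \<open>\<int> u/N + \<int> v/N\<close>
  (\<open>discrete_group_closure_rational\<close>). It does not matter whether \<open>u\<close> and \<open>v\<close> are themselves selected,
  so the search need not keep the choices consistent.

  Conversely, suppose that the selection given by \<open>J\<close> spans a discrete group. If \<open>n \<ge> 3\<close>, two of the
  indices 1, 2, 3 lie on the same side of \<open>J\<close>; the two vectors selected there belong to the same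
  family, so they are independent. A discrete plane group containing independent \<open>u\<close>, \<open>v\<close> consists of
  rational combinations of \<open>u\<close> and \<open>v\<close> (\<open>rational_if_discrete\<close>): the multiples of an
  element, reduced modulo \<open>u\<close> and \<open>v\<close>, stay in a bounded region, so two of them come
  arbitrarily close together and hence coincide. Thus this pair is a witness. For \<open>n = 2\<close>
  the pair \<open>e 1\<close>, \<open>e 2\<close> always is one, and for \<open>n < 2\<close> the choice \<open>J = {}\<close> works because a
  single vector spans a discrete group.

  The machine therefore tries all \<open>4 * n\<^sup>2\<close> ordered pairs. By Cramer's rule the coefficients with
  respect to a pair are quotients of determinants, so that membership in a rational span costs
  constant time, given the rationality test. Every pair needs \<open>O(n)\<close> such tests, which makes
  the running time cubic. Correctness and time of the program are proved together, by a
  weakest precondition calculus that carries a clock.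
\<close>

section \<open>Discrete plane groups and rational spans\<close>

definition det2 :: "real^2 \<Rightarrow> real^2 \<Rightarrow> real" where
  "det2 u v = u $ 1 * v $ 2 - u $ 2 * v $ 1"

text \<open>
  By Cramer's rule the two quotients are the coefficients of \<open>x\<close> with respect to \<open>u\<close> and \<open>v\<close>
  (lemma \<open>cramer\<close>), so for independent \<open>u\<close> and \<open>v\<close> this is the set of their rational combinations. For
  dependent ones both quotients are divisions by 0, and the set is the whole plane.
\<close>

definition rat_span :: "real^2 \<Rightarrow> real^2 \<Rightarrow> (real^2) set" where
  "rat_span u v = {x. det2 x v / det2 u v \<in> \<rat> \<and> det2 u x / det2 u v \<in> \<rat>}"

lemma det2_self [simp]: "det2 u u = 0"
  by (simp add: det2_def)

lemma det2_diff_left: "det2 (x - y) v = det2 x v - det2 y v"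
  and det2_diff_right: "det2 u (x - y) = det2 u x - det2 u y"
  and det2_zero_left: "det2 0 v = 0"
  and det2_zero_right: "det2 u 0 = 0"
  by (simp_all add: det2_def algebra_simps)

lemma cramer:
  assumes "det2 u v \<noteq> 0"
  shows "x = (det2 x v / det2 u v) *\<^sub>R u + (det2 u x / det2 u v) *\<^sub>R v"
proof -
  have "det2 u v *\<^sub>R x = det2 x v *\<^sub>R u + det2 u x *\<^sub>R v"
    by (simp add: vec_eq_iff forall_2 det2_def algebra_simps)
  then have "(1 / det2 u v) *\<^sub>R (det2 u v *\<^sub>R x)
      = (1 / det2 u v) *\<^sub>R (det2 x v *\<^sub>R u + det2 u x *\<^sub>R v)"
    by simp
  with assms show ?thesis
    by (simp add: scaleR_add_right)
qed

lemma det2_nonzero_if_not_parallel: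
  assumes "\<not> parallel u v"
  shows "det2 u v \<noteq> 0"
proof
  assume 0: "det2 u v = 0"
  have "collinear {0, u, v}"
  proof (cases "u = 0")
    case False
    define c where "c = (if u $ 1 \<noteq> 0 then v $ 1 / u $ 1 else v $ 2 / u $ 2)"
    have "u $ 1 \<noteq> 0 \<or> u $ 2 \<noteq> 0"
      using False by (auto simp: vec_eq_iff forall_2)
    then have "v = c *\<^sub>R u"
      using 0 by (auto simp: c_def vec_eq_iff forall_2 det2_def field_simps)
    then show ?thesis
      by (auto simp: collinear_lemma)
  qed (simp add: collinear_lemma)
  with assms show False
    by (simp add: parallel_def)
qed

lemma common_denominator:
  fixes A :: "real set"
  assumes "finite A" "A \<subseteq> \<rat>"
  shows "\<exists>N::int. N > 0 \<and> (\<forall>a\<in>A. of_int N * a \<in> \<int>)"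
  using assms
proof (induction A)
  case (insert a A)
  then obtain N :: int where N: "N > 0" "\<And>x. x \<in> A \<Longrightarrow> of_int N * x \<in> \<int>"
    by auto
  from insert.prems obtain p q :: int where q: "q > 0" "a = of_int p / of_int q"
    by (auto elim: Rats_cases')
  have "of_int (N * q) * a \<in> \<int>"
  proof -
    have "of_int (N * q) * a = of_int (N * p)"
      using q by simp
    then show ?thesis
      by (metis Ints_of_int)
  qed
  moreover have "of_int (N * q) * x \<in> \<int>" if "x \<in> A" for x
  proof -
    have "of_int (N * q) * x = of_int q * (of_int N * x)"
      by simp
    then show ?thesis
      by (metis N(2)[OF that] Ints_mult Ints_of_int)
  qed
  moreover have "N * q > 0"
    using N(1) q(1) by simp
  ultimately show ?case
    by (metis insert_iff)
qed (auto intro: exI[of _ 1])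

text \<open>
  After multiplication by a common denominator \<open>N\<close> of the generators, both coefficients are integers
  on the whole group, because they are additive. They are also continuous, and distinct integers differ
  by at least 1, so near a group element there is no other one with different coefficients.
\<close>

lemma discrete_group_closure_rational:
  assumes "finite S" "S \<subseteq> rat_span u v" "det2 u v \<noteq> 0"
  shows "discrete (group_closure S)"
proof -
  define f where "f x = det2 x v / det2 u v" for x
  define g where "g x = det2 u x / det2 u v" for x
  have "finite (f ` S \<union> g ` S)" "f ` S \<union> g ` S \<subseteq> \<rat>"
    using assms(1,2) by (auto simp: f_def g_def rat_span_def)
  then obtain N :: int where N: "N > 0"
      "\<And>x. x \<in> S \<Longrightarrow> of_int N * f x \<in> \<int>" "\<And>x. x \<in> S \<Longrightarrow> of_int N * g x \<in> \<int>"
    using common_denominator[of "f ` S \<union> g ` S"] by blast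
  have diff: "f (x - y) = f x - f y" "g (x - y) = g x - g y" for x y
    by (simp_all add: f_def g_def det2_diff_left det2_diff_right diff_divide_distrib)
  have integral: "of_int N * f x \<in> \<int> \<and> of_int N * g x \<in> \<int>" if "x \<in> group_closure S" for x
    using that
  proof induction
    case (base s)
    then show ?case
      using N by (auto simp: f_def g_def det2_zero_left det2_zero_right)
  next
    case (diff s t)
    then show ?case
      by (simp add: \<open>f (s - t) = f s - f t\<close> \<open>g (s - t) = g s - g t\<close> right_diff_distrib)
  qed
  have close: "a = b" if "a \<in> \<int>" "b \<in> \<int>" "\<bar>a - b\<bar> < 1" for a b :: real
    using that Ints_nonzero_abs_less1[of "a - b"] by auto
  show ?thesis
  proof (rule discreteI)
    fix x
    assume x: "x \<in> group_closure S"
    define T where "T = {y. \<bar>of_int N * f y - of_int N * f x\<bar> < 1} \<inter> {y. \<bar>of_int N * g y - of_int N * g x\<bar> < 1}"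
    have "open T"
      unfolding T_def f_def g_def det2_def divide_inverse
      by (intro open_Int open_Collect_less continuous_intros)
    moreover have "T \<inter> group_closure S = {x}"
    proof -
      have "y = x" if "y \<in> T" "y \<in> group_closure S" for y
      proof -
        have "of_int N * f y = of_int N * f x" "of_int N * g y = of_int N * g x"
          using that integral[OF x] integral[of y] close unfolding T_def by blast+
        then have "f y = f x" "g y = g x"
          using N(1) by simp_all
        then show ?thesis
          using cramer[OF assms(3)] unfolding f_def g_def by metis
      qed
      then show ?thesis
        using x by (auto simp: T_def)
    qed
    ultimately show "x isolated_in group_closure S"
      using x unfolding isolated_in_def by blast
  qed
qed

lemma group_closure_scaleR_int:
  fixes x :: "'a::real_vector"
  assumes "x \<in> group_closure S"
  shows "of_int k *\<^sub>R x \<in> group_closure S"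
proof -
  have nat: "of_nat m *\<^sub>R x \<in> group_closure S" for m
    using assms by (induction m) (auto simp: algebra_simps intro: group_closure_add)
  show ?thesis
  proof (cases k)
    case (nonneg m)
    then show ?thesis using nat[of m] by simp
  next
    case (neg m)
    then show ?thesis using nat[of "Suc m"] by (metis group_closure_minus_iff of_int_minus of_int_of_nat_eq scaleR_minus_left)
  qed
qed

text \<open>
  Reduce the multiples of \<open>x\<close> modulo \<open>u\<close> and \<open>v\<close>. The reduced points stay in the group and in the
  parallelogram spanned by \<open>u\<close> and \<open>v\<close>, hence have a convergent subsequence, and discreteness at 0 makes
  two of them equal. If the \<open>p\<close>-th and the \<open>q\<close>-th coincide, then \<open>q - p\<close> times each coefficient of \<open>x\<close> is
  an integer.
\<close>

lemma rational_if_discrete: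
  assumes disc: "discrete (group_closure S)"
    and uvx: "u \<in> group_closure S" "v \<in> group_closure S" "x \<in> group_closure S"
    and indep: "det2 u v \<noteq> 0"
  shows "x \<in> rat_span u v"
proof -
  define \<alpha> where "\<alpha> = det2 x v / det2 u v"
  define \<beta> where "\<beta> = det2 u x / det2 u v"
  have x: "x = \<alpha> *\<^sub>R u + \<beta> *\<^sub>R v"
    unfolding \<alpha>_def \<beta>_def using indep by (rule cramer)
  define f where "f k = frac (real k * \<alpha>) *\<^sub>R u + frac (real k * \<beta>) *\<^sub>R v" for k
  have f_in: "f k \<in> group_closure S" for k
  proof -
    have "f k = of_int (int k) *\<^sub>R x - of_int \<lfloor>real k * \<alpha>\<rfloor> *\<^sub>R u - of_int \<lfloor>real k * \<beta>\<rfloor> *\<^sub>R v"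
      by (simp add: f_def x frac_def algebra_simps)
    then show ?thesis
      by (simp only:) (intro group_closure.diff group_closure_scaleR_int uvx)
  qed
  have "norm (f k) \<le> norm u + norm v" for k
  proof -
    have "norm (f k) \<le> frac (real k * \<alpha>) * norm u + frac (real k * \<beta>) * norm v"
      unfolding f_def by (rule norm_triangle_le) simp
    also have "\<dots> \<le> 1 * norm u + 1 * norm v"
      by (intro add_mono mult_right_mono) (simp_all add: frac_lt_1 less_imp_le)
    finally show ?thesis by simp
  qed
  then have "bounded (range f)"
    by (auto simp: bounded_iff)
  then obtain l r where r: "strict_mono (r :: nat \<Rightarrow> nat)" "(f \<circ> r) \<longlonglongrightarrow> l"
    using bounded_imp_convergent_subsequence by blast
  have "0 isolated_in group_closure S"
    using disc by (simp add: discreteD)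
  then obtain \<epsilon> where eps: "\<epsilon> > 0" "\<And>y. y \<in> group_closure S \<Longrightarrow> norm y < \<epsilon> \<Longrightarrow> y = 0"
    unfolding isolated_in_dist_Ex_iff by auto
  from r(2) have "Cauchy (f \<circ> r)"
    by (rule LIMSEQ_imp_Cauchy)
  then obtain M where M: "\<And>m n. m \<ge> M \<Longrightarrow> n \<ge> M \<Longrightarrow> dist (f (r m)) (f (r n)) < \<epsilon>"
    using eps(1) unfolding Cauchy_def comp_def by blast
  define p where "p = r M"
  define q where "q = r (Suc M)"
  have pq: "p < q"
    unfolding p_def q_def using r(1) by (simp add: strict_mono_Suc_iff)
  have "f q - f p = 0"
    using M[of "Suc M" M] by (intro eps group_closure.diff f_in) (simp add: p_def q_def dist_norm)
  then have eq: "f q = f p"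
    by simp
  \<comment> \<open>Independence recovers the fractional parts from the reduced point.\<close>
  have "det2 (f k) v = frac (real k * \<alpha>) * det2 u v" "det2 u (f k) = frac (real k * \<beta>) * det2 u v" for k
    by (simp_all add: f_def det2_def algebra_simps)
  with eq indep have fracs: "frac (real q * \<alpha>) = frac (real p * \<alpha>)" "frac (real q * \<beta>) = frac (real p * \<beta>)"
    by (metis mult_right_cancel)+
  have rational: "\<gamma> \<in> \<rat>" if "frac (real q * \<gamma>) = frac (real p * \<gamma>)" for \<gamma>
  proof -
    have "\<gamma> = of_int (\<lfloor>real q * \<gamma>\<rfloor> - \<lfloor>real p * \<gamma>\<rfloor>) / of_int (int q - int p)"
      using that pq by (simp add: frac_def field_simps)
    then show ?thesis
      by (metis Rats_divide Rats_of_int)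
  qed
  show ?thesis
    using rational fracs by (simp add: rat_span_def \<alpha>_def \<beta>_def)
qed

text \<open>
  Completing \<open>w\<close> by a perpendicular vector to a basis makes this an instance of the planar criterion.
\<close>

lemma discrete_group_closure_singleton:
  assumes "w \<noteq> 0" "S \<subseteq> {w}"
  shows "discrete (group_closure S :: (real^2) set)"
proof -
  \<comment> \<open>the vector \<open>w\<close> turned by a right angle\<close>
  define v :: "real^2" where "v = vector [- (w $ 2), w $ 1]"
  have "det2 w v = (w $ 1)\<^sup>2 + (w $ 2)\<^sup>2"
    by (simp add: det2_def v_def power2_eq_square)
  moreover have "w $ 1 \<noteq> 0 \<or> w $ 2 \<noteq> 0"
    using assms(1) by (auto simp: vec_eq_iff forall_2)
  ultimately have "det2 w v \<noteq> 0"
    by (simp add: sum_power2_eq_zero_iff)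
  moreover from this have "S \<subseteq> rat_span w v"
    using assms(2) by (auto simp: rat_span_def)
  moreover have "finite S"
    using assms(2) finite_subset by blast
  ultimately show ?thesis
    using discrete_group_closure_rational by blast
qed

definition witness_pair :: "nat \<Rightarrow> (nat \<Rightarrow> real^2) \<Rightarrow> (nat \<Rightarrow> real^2) \<Rightarrow> real^2 \<Rightarrow> real^2 \<Rightarrow> bool" where
  "witness_pair n e \<tau> u v \<longleftrightarrow> det2 u v \<noteq> 0 \<and>
    (\<forall>j\<in>{1..n}. e j \<in> rat_span u v \<or> \<tau> j \<in> rat_span u v)"

lemma discrete_if_witness_pair:
  assumes "witness_pair n e \<tau> u v"
  shows "discrete (mixed_span e \<tau> n {j\<in>{1..n}. e j \<notin> rat_span u v})"
  unfolding mixed_span_def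
  by (rule discrete_group_closure_rational[of _ u v])
    (use assms in \<open>auto simp: witness_pair_def\<close>)

text \<open>
  Any three selected vectors include two of the same family, which are independent. Two selected
  vectors may be parallel, one from each family, so \<open>n = 2\<close> is treated separately: there \<open>e 1\<close> and
  \<open>e 2\<close> cover both indices, whatever \<open>J\<close> is.
\<close>

lemma witness_pair_if_discrete:
  assumes n: "n \<ge> 2" and J: "discrete (mixed_span e \<tau> n J)"
    and e: "pairwise (\<lambda>i j. \<not> parallel (e i) (e j)) {1..n}"
    and \<tau>: "pairwise (\<lambda>i j. \<not> parallel (\<tau> i) (\<tau> j)) {1..n}"
  shows "\<exists>u\<in>e ` {1..n} \<union> \<tau> ` {1..n}. \<exists>v\<in>e ` {1..n} \<union> \<tau> ` {1..n}. witness_pair n e \<tau> u v"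
proof (cases "n = 2")
  case True
  have set: "{1..n} = {1, 2}"
    using True by auto
  have "det2 (e 1) (e 2) \<noteq> 0"
    using e n by (intro det2_nonzero_if_not_parallel) (auto simp: pairwise_def)
  then have "witness_pair n e \<tau> (e 1) (e 2)"
    unfolding witness_pair_def set by (simp add: rat_span_def)
  then show ?thesis
    unfolding set by blast
next
  case False
  define c where "c j = (if j \<in> J then \<tau> j else e j)" for j
  have c_in: "c j \<in> mixed_span e \<tau> n J" if "j \<in> {1..n}" for j
    using that unfolding c_def mixed_span_def by (auto intro!: group_closure.base)
  have "\<exists>i\<in>{1,2,3::nat}. \<exists>j\<in>{1,2,3}. i \<noteq> j \<and> (i \<in> J \<longleftrightarrow> j \<in> J)"
    by auto
  moreover have "{1,2,3} \<subseteq> {1..n}"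
    using n False by auto
  ultimately obtain i j where ij: "i \<in> {1..n}" "j \<in> {1..n}" "i \<noteq> j" "i \<in> J \<longleftrightarrow> j \<in> J"
    by blast
  then have "\<not> parallel (c i) (c j)"
    using e \<tau> by (auto simp: c_def pairwise_def)
  then have indep: "det2 (c i) (c j) \<noteq> 0"
    by (rule det2_nonzero_if_not_parallel)
  have "c k \<in> rat_span (c i) (c j)" if "k \<in> {1..n}" for k
    using rational_if_discrete[OF J[unfolded mixed_span_def] _ _ _ indep]
      c_in[unfolded mixed_span_def] ij that by blast
  then have "witness_pair n e \<tau> (c i) (c j)"
    unfolding witness_pair_def using indep by (metis c_def)
  moreover have "c i \<in> e ` {1..n} \<union> \<tau> ` {1..n}" "c j \<in> e ` {1..n} \<union> \<tau> ` {1..n}"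
    using ij by (auto simp: c_def)
  ultimately show ?thesis by blast
qed

section \<open>Weakest preconditions with a clock\<close>

text \<open>
  The clock \<open>t\<close> shows the time used before \<open>c\<close> starts, and the postcondition sees the clock reading at
  the end. Time bounds thus become ordinary parts of postconditions and loop invariants.
\<close>

definition wp :: "com \<Rightarrow> (nat \<Rightarrow> state \<Rightarrow> bool) \<Rightarrow> nat \<Rightarrow> state \<Rightarrow> bool" where
  "wp c Q t s \<longleftrightarrow> (\<exists>d s'. run c s d s' \<and> Q (t + d) s')"

definition block :: "com list \<Rightarrow> com" where
  "block cs = foldr Seq cs Skip"

text \<open>
  Since the machine is deterministic, the rules are equations rather than implications, and the
  simplifier can execute straight-line code symbolically. It simplifies every intermediate state
  before it goes on, which keeps the terms small.
\<close>

lemma wp_run: "run c s d s' \<Longrightarrow> wp c Q t s \<longleftrightarrow> Q (t + d) s'"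
  unfolding wp_def using run_deterministic by blast

lemmas wp_basic [simp] =
  run_Skip [THEN wp_run] run_IConst [THEN wp_run] run_IAdd [THEN wp_run]
  run_RConst [THEN wp_run] run_Load [THEN wp_run] run_Emit [THEN wp_run]

lemma wp_ROp [simp]:
  "wp (ROp f d a b) Q t s \<longleftrightarrow> \<not> (f = Div \<and> rreg s b = 0) \<and>
    Q (t + 1) (s\<lparr>rreg := (rreg s)(d := aop_val f (rreg s a) (rreg s b))\<rparr>)"
proof (cases "f = Div \<and> rreg s b = 0")
  case True
  then show ?thesis
    by (auto simp: wp_def elim: run_elims)
next
  case False
  from wp_run[OF run_ROp[OF this]] False show ?thesis
    by simp
qed

lemma wp_Seq: "wp (Seq c1 c2) Q t s \<longleftrightarrow> wp c1 (wp c2 Q) t s"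
proof
  assume "wp (Seq c1 c2) Q t s"
  then show "wp c1 (wp c2 Q) t s"
    unfolding wp_def by (metis run_elims(10) add.assoc)
next
  assume "wp c1 (wp c2 Q) t s"
  then show "wp (Seq c1 c2) Q t s"
    unfolding wp_def by (metis run_Seq add.assoc)
qed

text \<open>
  The clock and the state are left out on both sides so that rewriting also reaches a block that is
  the continuation of another command. The final \<open>Skip\<close> of a block costs one unit.
\<close>

lemma wp_block [simp]:
  "wp (block []) Q = (\<lambda>t. Q (t + 1))"
  "wp (block (c # cs)) Q = wp c (wp (block cs) Q)"
  by (simp_all add: block_def wp_Seq fun_eq_iff)

lemma wp_Cond [simp]:
  "wp (Cond b c1 c2) Q t s \<longleftrightarrow> (if test_val b s then wp c1 Q (t + 1) s else wp c2 Q (t + 1) s)"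
proof -
  have "run (Cond b c1 c2) s d s' \<longleftrightarrow> (\<exists>k. d = Suc k \<and> run (if test_val b s then c1 else c2) s k s')"
    for d s'
    by (auto elim: run_elims intro: run_CondTrue run_CondFalse)
  then show ?thesis
    unfolding wp_def by (cases "test_val b s") (simp_all, metis add_Suc_right, metis add_Suc_right)
qed

text \<open>
  In a counting loop the invariant \<open>Inv k\<close> describes clock and state after \<open>k\<close> completed rounds; the
  counter shows \<open>k\<close> and the bound never changes, so there are exactly \<open>N\<close> rounds.
\<close>

lemma wp_count:
  assumes init: "Inv 0 t s"
    and counter: "\<And>k t s. Inv k t s \<Longrightarrow> ireg s i = k \<and> ireg s m = N"
    and step: "\<And>k t s. k < N \<Longrightarrow> Inv k t s \<Longrightarrow> wp c (Inv (Suc k)) (t + 1) s"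
    and post: "\<And>t s. Inv N t s \<Longrightarrow> Q (t + 1) s"
  shows "wp (While (ILess i m) c) Q t s"
proof -
  have "wp (While (ILess i m) c) Q t s" if "Inv k t s" "k \<le> N" for k t s
    using that
  proof (induction "N - k" arbitrary: k t s)
    case 0
    then have "k = N" by simp
    with 0 show ?case
      using counter[of k t s] post run_WhileFalse[of "ILess i m" s c] unfolding wp_def by force
  next
    case (Suc d)
    then have k: "k < N" by simp
    from step[OF k Suc.prems(1)] obtain d1 s1
      where 1: "run c s d1 s1" "Inv (Suc k) (t + 1 + d1) s1"
      by (auto simp: wp_def)
    from Suc.hyps(1)[of "Suc k", OF _ 1(2)] Suc.hyps(2) k
    have "wp (While (ILess i m) c) Q (t + 1 + d1) s1"
      by simp
    then obtain d2 s2
      where 2: "run (While (ILess i m) c) s1 d2 s2" "Q (t + 1 + d1 + d2) s2"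
      by (auto simp: wp_def)
    have "test_val (ILess i m) s"
      using counter[OF Suc.prems(1)] k by simp
    then have "run (While (ILess i m) c) s (Suc (d1 + d2)) s2"
      using 1(1) 2(1) by (rule run_WhileTrue)
    with 2(2) show ?case
      unfolding wp_def by (metis add.assoc plus_1_eq_Suc)
  qed
  from this[OF init] show ?thesis by simp
qed

section \<open>The program\<close>

text \<open>
  Index registers: 0 holds \<open>n\<close>, 2 the constant 1, 3 the number \<open>2 * n\<close> of vectors, and 15 the
  constant 0, so that adding register 15 copies a register. Registers 4 and 5 run over the pairs, 6 over
  the indices of the problem, and 7 is an address. A successful pair is recorded in 8 and 9, and 10
  tells whether there is one. Register 11 tells whether the current pair has passed so far; 12 and 14
  receive the outcomes of membership tests, and 13 is the position of the vector \<open>\<tau> j\<close>.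

  Real registers: 2, 3 and 4, 5 hold the current pair, 8 its determinant, and 6, 7 the vector under
  test; 9 and 10 are temporary, 11 and 12 receive the coefficients, and 13 is 0 for comparison.

  In memory, vector number \<open>k\<close> occupies the cells \<open>2 * k\<close> and \<open>2 * k + 1\<close>; the vectors of the first
  family come before those of the second, both counted from 0.
\<close>

definition load_vector :: "reg \<Rightarrow> reg \<Rightarrow> com" where
  "load_vector d k = block [IAdd 7 k k, Load d 7, IAdd 7 7 2, Load (d + 1) 7]"

definition compute_det2 :: "reg \<Rightarrow> reg \<Rightarrow> reg \<Rightarrow> com" where
  "compute_det2 d p q = block
    [ROp Mul 9 p (q + 1), ROp Mul 10 (p + 1) q, ROp Sub d 9 10]"

definition load_pair :: "reg \<Rightarrow> reg \<Rightarrow> com" where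
  "load_pair a b = block [load_vector 2 a, load_vector 4 b, compute_det2 8 2 4]"

text \<open>
  The vector whose number is in \<open>k\<close> is tested against the current pair, whose determinant must be
  nonzero: both coefficients given by Cramer's rule have to be rational.
\<close>

definition span_test :: "reg \<Rightarrow> reg \<Rightarrow> com" where
  "span_test f k = block
    [load_vector 6 k,
     compute_det2 11 6 4, ROp Div 11 11 8,
     compute_det2 12 2 6, ROp Div 12 12 8,
     IConst f 0,
     Cond (IsRat 11) (Cond (IsRat 12) (IConst f 1) Skip) Skip]"

text \<open>
  The sum of the two outcomes is 0 exactly if neither vector with the current index is a rational
  combination of the pair.
\<close>

definition cover_test :: com where
  "cover_test = block
    [IConst 11 1, IConst 6 0,
     While (ILess 6 0) (block
       [span_test 12 6, IAdd 13 0 6, span_test 14 13, IAdd 12 12 14,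
        Cond (IEq 12 15) (IConst 11 0) Skip,
        IAdd 6 6 2])]"

definition pair_test :: com where
  "pair_test = block
    [load_pair 4 5, RConst 13 0,
     Cond (REq 8 13) Skip (block
       [cover_test,
        Cond (IEq 11 2) (block [IAdd 8 4 15, IAdd 9 5 15, IConst 10 1]) Skip])]"

definition row_search :: com where
  "row_search = block
    [IConst 5 0,
     While (ILess 5 3) (block [pair_test, IAdd 5 5 2]),
     IAdd 4 4 2]"

definition search :: com where
  "search = block [IConst 4 0, While (ILess 4 3) row_search]"

text \<open>
  The counter is advanced before the output because positions in memory count from 0, but the
  indices of the problem count from 1.
\<close>

definition report :: com where
  "report = block
    [load_pair 8 9, Emit 2, IConst 6 0,
     While (ILess 6 0) (block
       [span_test 12 6, IAdd 6 6 2, Cond (IEq 12 15) (Emit 6) Skip])]"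

text \<open>
  For \<open>n < 2\<close> the empty set always works, but \<open>e 1\<close> and \<open>\<tau> 1\<close> may be parallel, and then the search
  would find no pair.
\<close>

definition decide :: com where
  "decide = block
    [IConst 2 1,
     Cond (ILess 2 0)
       (block [IAdd 3 0 0, search, Cond (IEq 10 15) (Emit 15) report])
       (Emit 2)]"

section \<open>Correctness and running time of the program\<close>

definition stored :: "(nat \<Rightarrow> real^2) \<Rightarrow> state \<Rightarrow> bool" where
  "stored w s \<longleftrightarrow> (\<forall>k. memory s (2 * k) = w k $ 1 \<and> memory s (2 * k + 1) = w k $ 2)"

definition pair_loaded :: "real^2 \<Rightarrow> real^2 \<Rightarrow> state \<Rightarrow> bool" where
  "pair_loaded u v s \<longleftrightarrow> rreg s 2 = u $ 1 \<and> rreg s 3 = u $ 2 \<and>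
    rreg s 4 = v $ 1 \<and> rreg s 5 = v $ 2 \<and> rreg s 8 = det2 u v"

definition valid_pair :: "nat \<Rightarrow> (nat \<Rightarrow> real^2) \<Rightarrow> nat \<Rightarrow> nat \<Rightarrow> bool" where
  "valid_pair n w a b \<longleftrightarrow> det2 (w a) (w b) \<noteq> 0 \<and>
    (\<forall>j<n. w j \<in> rat_span (w a) (w b) \<or> w (n + j) \<in> rat_span (w a) (w b))"

text \<open>
  The facts that hold after the setup and that no later part of the program destroys.
\<close>

definition ready :: "nat \<Rightarrow> (nat \<Rightarrow> real^2) \<Rightarrow> state \<Rightarrow> bool" where
  "ready n w s \<longleftrightarrow> ireg s 0 = n \<and> ireg s 2 = 1 \<and> ireg s 3 = 2 * n \<and> ireg s 15 = 0 \<and> stored w s"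

text \<open>
  The frame condition of a subroutine that only writes the index registers \<open>I\<close> and the real registers \<open>R\<close>.
\<close>

definition same_except :: "reg set \<Rightarrow> reg set \<Rightarrow> state \<Rightarrow> state \<Rightarrow> bool" where
  "same_except I R s s' \<longleftrightarrow> (\<forall>i. i \<notin> I \<longrightarrow> ireg s' i = ireg s i) \<and>
    (\<forall>r. r \<notin> R \<longrightarrow> rreg s' r = rreg s r) \<and> memory s' = memory s \<and> tape s' = tape s"

text \<open>
  Here and below the time bounds are generous round numbers; all that matters is that one round of
  each loop is bounded by a constant, apart from the time of the loops inside it.
\<close>

lemma wp_load_pair:
  assumes "stored w s" "ireg s 2 = 1" "a \<noteq> 7" "b \<noteq> 7"
    and "\<And>t' s'. t' \<le> t + 20 \<Longrightarrow> same_except {7} {2,3,4,5,8,9,10} s s' \<Longrightarrow>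
      pair_loaded (w (ireg s a)) (w (ireg s b)) s' \<Longrightarrow> Q t' s'"
  shows "wp (load_pair a b) Q t s"
  using assms(1-4)
  by (auto simp: load_pair_def load_vector_def compute_det2_def stored_def mult_2[symmetric]
      same_except_def pair_loaded_def det2_def intro!: assms(5))

lemma wp_span_test:
  assumes "stored w s" "ireg s 2 = 1" "k \<noteq> 7" "f \<noteq> 7" "pair_loaded u v s" "det2 u v \<noteq> 0"
    and "\<And>t' s'. t' \<le> t + 30 \<Longrightarrow> same_except {7, f} {6,7,9,10,11,12} s s' \<Longrightarrow>
      ireg s' f = of_bool (w (ireg s k) \<in> rat_span u v) \<Longrightarrow> Q t' s'"
  shows "wp (span_test f k) Q t s"
  using assms(1-6)
  by (auto simp: span_test_def load_vector_def compute_det2_def stored_def mult_2[symmetric]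
      same_except_def pair_loaded_def det2_def rat_span_def intro!: assms(7))

lemma wp_cover_test:
  assumes "ready n w s" "pair_loaded u v s" "det2 u v \<noteq> 0"
    and Q: "\<And>t' s'. t' \<le> t + 100 * n + 10 \<Longrightarrow>
      same_except {6,7,11,12,13,14} {6,7,9,10,11,12} s s' \<Longrightarrow>
      ireg s' 11 = of_bool (\<forall>j<n. w j \<in> rat_span u v \<or> w (n + j) \<in> rat_span u v) \<Longrightarrow> Q t' s'"
  shows "wp cover_test Q t s"
proof -
  define Inv where "Inv k t' s' \<longleftrightarrow> t' \<le> t + 100 * k + 2 \<and>
      same_except {6,7,11,12,13,14} {6,7,9,10,11,12} s s' \<and> ireg s' 6 = k \<and>
      ireg s' 11 = of_bool (\<forall>j<k. w j \<in> rat_span u v \<or> w (n + j) \<in> rat_span u v)" for k t' s'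
  have inv: "ready n w s'" "pair_loaded u v s'" if "Inv k t' s'" for k t' s'
    using that assms(1,2)
    by (auto simp: Inv_def ready_def pair_loaded_def same_except_def stored_def)
  have "wp (While (ILess 6 0) (block [span_test 12 6, IAdd 13 0 6, span_test 14 13, IAdd 12 12 14,
      Cond (IEq 12 15) (IConst 11 0) Skip, IAdd 6 6 2])) (wp (block []) Q) t' s'" if "Inv 0 t' s'" for t' s'
  proof (rule wp_count[where Inv = Inv and N = n])
    fix k t' s'
    assume *: "Inv k t' s'"
    show "ireg s' 6 = k \<and> ireg s' 0 = n"
      using * inv[OF *] by (simp add: Inv_def ready_def)
    show "wp (block [span_test 12 6, IAdd 13 0 6, span_test 14 13, IAdd 12 12 14,
        Cond (IEq 12 15) (IConst 11 0) Skip, IAdd 6 6 2]) (Inv (Suc k)) (t' + 1) s'"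
      using inv[OF *] assms(3) * unfolding wp_block
      by (intro wp_span_test[where w = w and u = u and v = v]; simp add: ready_def)
        (intro wp_span_test[where w = w and u = u and v = v];
          auto simp: same_except_def ready_def Inv_def stored_def pair_loaded_def less_Suc_eq)
  next
    fix t' s' assume "Inv n t' s'"
    then show "wp (block []) Q (t' + 1) s'"
      by (auto simp: Inv_def intro: Q)
  qed (fact that)
  then show ?thesis
    by (auto simp: cover_test_def Inv_def same_except_def)
qed

lemma wp_pair_test:
  assumes "ready n w s"
    and Q: "\<And>t' s'. t' \<le> t + 100 * n + 40 \<Longrightarrow> same_except {6,7,8,9,10,11,12,13,14} UNIV s s' \<Longrightarrow>
      (if valid_pair n w (ireg s 4) (ireg s 5)
       then ireg s' 8 = ireg s 4 \<and> ireg s' 9 = ireg s 5 \<and> ireg s' 10 = 1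
       else ireg s' 8 = ireg s 8 \<and> ireg s' 9 = ireg s 9 \<and> ireg s' 10 = ireg s 10) \<Longrightarrow>
      Q t' s'"
  shows "wp pair_test Q t s"
  unfolding pair_test_def wp_block
proof (rule wp_load_pair[where w = w], goal_cases)
  case (5 t1 s1)
  let ?u = "w (ireg s 4)" and ?v = "w (ireg s 5)"
  note t1 = 5(1) and same1 = 5(2) and loaded = 5(3)
  show ?case
  proof (cases "det2 ?u ?v = 0")
    case True
    then show ?thesis
      using t1 same1 loaded
      by (auto simp: pair_loaded_def same_except_def valid_pair_def intro!: Q)
  next
    case False
    let ?s2 = "s1\<lparr>rreg := (rreg s1)(13 := 0)\<rparr>"
    have "wp cover_test (wp (block [Cond (IEq 11 2)
        (block [IAdd 8 4 15, IAdd 9 5 15, IConst 10 1]) Skip]) (wp (block []) Q)) (t1 + 2) ?s2"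
    proof (rule wp_cover_test[where n = n and w = w and u = ?u and v = ?v])
      show "ready n w ?s2" "pair_loaded ?u ?v ?s2"
        using assms(1) same1 loaded by (auto simp: ready_def stored_def same_except_def pair_loaded_def)
    next
      fix t3 s3
      assume "t3 \<le> t1 + 2 + 100 * n + 10"
        and "same_except {6,7,11,12,13,14} {6,7,9,10,11,12} ?s2 s3"
        and "ireg s3 11 = of_bool (\<forall>j<n. w j \<in> rat_span ?u ?v \<or> w (n + j) \<in> rat_span ?u ?v)"
      then show "wp (block [Cond (IEq 11 2)
          (block [IAdd 8 4 15, IAdd 9 5 15, IConst 10 1]) Skip]) (wp (block []) Q) t3 s3"
        using t1 same1 False assms(1)
        by (auto simp: same_except_def ready_def valid_pair_def intro!: Q)
    qed (fact False)
    then show ?thesis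
      using False loaded by (simp add: pair_loaded_def)
  qed
qed (use assms in \<open>auto simp: ready_def\<close>)

text \<open>
  The state of the search once the pairs in \<open>W\<close> have been tried. A later success overwrites an
  earlier one, so the recorded pair need only be valid.
\<close>

definition searched :: "nat \<Rightarrow> (nat \<Rightarrow> real^2) \<Rightarrow> (nat \<times> nat) set \<Rightarrow> state \<Rightarrow> bool" where
  "searched n w W s \<longleftrightarrow>
    (ireg s 10 = 0 \<and> (\<forall>(a, b)\<in>W. \<not> valid_pair n w a b)) \<or>
    (ireg s 10 = 1 \<and> valid_pair n w (ireg s 8) (ireg s 9))"

lemma wp_row_search:
  assumes "ready n w s" "searched n w ({..<ireg s 4} \<times> {..<2 * n}) s"
    and Q: "\<And>t' s'. t' \<le> t + 2 * n * (100 * n + 50) + 5 \<Longrightarrow>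
      same_except {4,5,6,7,8,9,10,11,12,13,14} UNIV s s' \<Longrightarrow> ireg s' 4 = Suc (ireg s 4) \<Longrightarrow>
      searched n w ({..<Suc (ireg s 4)} \<times> {..<2 * n}) s' \<Longrightarrow> Q t' s'"
  shows "wp row_search Q t s"
proof -
  \<comment> \<open>the rows before the current one, and the first \<open>k\<close> pairs of the current row\<close>
  define W where "W k = {..<ireg s 4} \<times> {..<2 * n} \<union> {ireg s 4} \<times> {..<k}" for k
  define Inv where "Inv k t' s' \<longleftrightarrow> t' \<le> t + k * (100 * n + 50) + 1 \<and>
      same_except {5,6,7,8,9,10,11,12,13,14} UNIV s s' \<and> ireg s' 5 = k \<and> searched n w (W k) s'"
    for k t' s'
  have inv: "ready n w s'" if "Inv k t' s'" for k t' s'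
    using that assms(1) by (auto simp: Inv_def ready_def same_except_def stored_def)
  have W_Suc: "W (Suc k) = insert (ireg s 4, k) (W k)" for k
    by (auto simp: W_def)
  have W_full: "W (2 * n) = {..<Suc (ireg s 4)} \<times> {..<2 * n}"
    by (auto simp: W_def less_Suc_eq)
  have "wp (While (ILess 5 3) (block [pair_test, IAdd 5 5 2])) (wp (block [IAdd 4 4 2]) Q) t' s'"
    if "Inv 0 t' s'" for t' s'
  proof (rule wp_count[where Inv = Inv and N = "2 * n"])
    fix k t' s'
    assume *: "Inv k t' s'"
    show "ireg s' 5 = k \<and> ireg s' 3 = 2 * n"
      using * inv[OF *] by (simp add: Inv_def ready_def)
    show "wp (block [pair_test, IAdd 5 5 2]) (Inv (Suc k)) (t' + 1) s'"
      unfolding wp_block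
    proof (rule wp_pair_test[where w = w, OF inv[OF *]], goal_cases)
      case (1 t2 s2)
      then show ?case
        using inv[OF *] *
        by (auto simp: Inv_def W_Suc searched_def same_except_def ready_def split: if_splits)
    qed
  next
    fix t' s'
    assume *: "Inv (2 * n) t' s'"
    then show "wp (block [IAdd 4 4 2]) Q (t' + 1) s'"
      using inv[OF *]
      by (auto simp: Inv_def W_full ready_def same_except_def searched_def intro!: Q)
  qed (fact that)
  moreover have "Inv 0 (t + 1) (s\<lparr>ireg := (ireg s)(5 := 0)\<rparr>)"
    using assms(2) by (simp add: Inv_def W_def same_except_def searched_def)
  ultimately show ?thesis
    by (simp add: row_search_def)
qed

lemma wp_search:
  assumes "ready n w s" "ireg s 10 = 0"
    and Q: "\<And>t' s'. t' \<le> t + 2 * n * (2 * n * (100 * n + 50) + 6) + 3 \<Longrightarrow>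
      same_except {4,5,6,7,8,9,10,11,12,13,14} UNIV s s' \<Longrightarrow>
      searched n w ({..<2 * n} \<times> {..<2 * n}) s' \<Longrightarrow> Q t' s'"
  shows "wp search Q t s"
proof -
  define Inv where "Inv k t' s' \<longleftrightarrow> t' \<le> t + k * (2 * n * (100 * n + 50) + 6) + 1 \<and>
      same_except {4,5,6,7,8,9,10,11,12,13,14} UNIV s s' \<and> ireg s' 4 = k \<and>
      searched n w ({..<k} \<times> {..<2 * n}) s'" for k t' s'
  have inv: "ready n w s'" if "Inv k t' s'" for k t' s'
    using that assms(1) by (auto simp: Inv_def ready_def same_except_def stored_def)
  have "wp (While (ILess 4 3) row_search) (wp (block []) Q) t' s'" if "Inv 0 t' s'" for t' s'
  proof (rule wp_count[where Inv = Inv and N = "2 * n"])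
    fix k t' s'
    assume *: "Inv k t' s'"
    show "ireg s' 4 = k \<and> ireg s' 3 = 2 * n"
      using * inv[OF *] by (simp add: Inv_def ready_def)
    show "wp row_search (Inv (Suc k)) (t' + 1) s'"
      by (rule wp_row_search[OF inv[OF *]]) (use * in \<open>auto simp: Inv_def same_except_def\<close>)
  next
    fix t' s'
    assume "Inv (2 * n) t' s'"
    then show "wp (block []) Q (t' + 1) s'"
      by (auto simp: Inv_def intro!: Q)
  qed (fact that)
  moreover have "Inv 0 (t + 1) (s\<lparr>ireg := (ireg s)(4 := 0)\<rparr>)"
    using assms(2) by (simp add: Inv_def same_except_def searched_def)
  ultimately show ?thesis
    by (simp add: search_def)
qed

lemma wp_report:
  fixes w s
  defines "u \<equiv> w (ireg s 8)" and "v \<equiv> w (ireg s 9)"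
  assumes "ready n w s" "det2 u v \<noteq> 0"
    and Q: "\<And>t' s'. t' \<le> t + 40 * n + 30 \<Longrightarrow>
      tape s' = tape s @ 1 # filter (\<lambda>j. w (j - 1) \<notin> rat_span u v) [1..<Suc n] \<Longrightarrow> Q t' s'"
  shows "wp report Q t s"
  unfolding report_def wp_block
proof (rule wp_load_pair[where w = w], goal_cases)
  case (5 t1 s1)
  note s1 = this
  define Inv where "Inv k t' s' \<longleftrightarrow> t' \<le> t1 + 40 * k + 2 \<and> ready n w s' \<and> pair_loaded u v s' \<and>
      ireg s' 6 = k \<and>
      tape s' = tape s @ 1 # filter (\<lambda>j. w (j - 1) \<notin> rat_span u v) [1..<Suc k]" for k t' s'
  have "wp (While (ILess 6 0) (block [span_test 12 6, IAdd 6 6 2, Cond (IEq 12 15) (Emit 6) Skip]))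
      (wp (block []) Q) t' s'" if "Inv 0 t' s'" for t' s'
  proof (rule wp_count[where Inv = Inv and N = n])
    fix k t' s'
    assume *: "Inv k t' s'"
    then show "ireg s' 6 = k \<and> ireg s' 0 = n"
      by (simp add: Inv_def ready_def)
    show "wp (block [span_test 12 6, IAdd 6 6 2, Cond (IEq 12 15) (Emit 6) Skip]) (Inv (Suc k)) (t' + 1) s'"
      unfolding wp_block
      by (rule wp_span_test[where w = w and u = u and v = v])
        (use * assms(4) in \<open>auto simp: Inv_def ready_def pair_loaded_def same_except_def stored_def\<close>)
  next
    fix t' s'
    assume "Inv n t' s'"
    then show "wp (block []) Q (t' + 1) s'"
      using s1 by (auto simp: Inv_def intro!: Q)
  qed (fact that)
  moreover have "Inv 0 (t1 + 2) (s1\<lparr>tape := tape s1 @ [1], ireg := (ireg s1)(6 := 0)\<rparr>)"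
    using s1 assms(3) by (auto simp: Inv_def u_def v_def ready_def same_except_def stored_def pair_loaded_def)
  moreover have "ireg s1 2 = 1"
    using s1(2) assms(3) by (simp add: same_except_def ready_def)
  ultimately show ?case
    by simp
qed (use assms(3) in \<open>auto simp: ready_def\<close>)

lemma wp_decide:
  assumes "ireg s = (\<lambda>_. 0)(0 := n)" "stored w s" "tape s = []"
    and Q: "\<And>t' s'. t' \<le> t + 400 * n ^ 3 + 300 * n ^ 2 + 60 * n + 60 \<Longrightarrow>
      n < 2 \<and> tape s' = [1] \<or>
      n \<ge> 2 \<and> tape s' = [0] \<and> \<not> (\<exists>a<2 * n. \<exists>b<2 * n. valid_pair n w a b) \<or>
      (\<exists>a b. valid_pair n w a b \<and>
        tape s' = 1 # filter (\<lambda>j. w (j - 1) \<notin> rat_span (w a) (w b)) [1..<Suc n]) \<Longrightarrow> Q t' s'"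
  shows "wp decide Q t s"
proof (cases "n < 2")
  case True
  then show ?thesis
    using assms(1,3) by (auto simp: decide_def intro!: Q)
next
  case False
  let ?s = "s\<lparr>ireg := (ireg s)(2 := 1, 3 := 2 * n)\<rparr>"
  have "wp search (wp (block [Cond (IEq 10 15) (Emit 15) report]) (wp (block []) Q)) (t + 3) ?s"
  proof (rule wp_search[where n = n and w = w])
    show ready: "ready n w ?s"
      using assms(1,2) by (simp add: ready_def stored_def)
    fix t1 s1
    assume s1: "t1 \<le> t + 3 + 2 * n * (2 * n * (100 * n + 50) + 6) + 3"
      "same_except {4,5,6,7,8,9,10,11,12,13,14} UNIV ?s s1"
      "searched n w ({..<2 * n} \<times> {..<2 * n}) s1"
    have t1: "t1 \<le> t + 400 * n ^ 3 + 200 * n ^ 2 + 12 * n + 6"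
      using s1(1) by (simp add: power2_eq_square power3_eq_cube algebra_simps)
    have tape: "tape s1 = []" and zero: "ireg s1 15 = 0" and ready1: "ready n w s1"
      using s1(2) ready assms(1,3) by (auto simp: same_except_def ready_def stored_def)
    show "wp (block [Cond (IEq 10 15) (Emit 15) report]) (wp (block []) Q) t1 s1"
    proof (cases "ireg s1 10 = 0")
      case True
      then show ?thesis
        using s1(3) t1 tape zero False by (auto simp: searched_def intro!: Q)
    next
      case nonzero: False
      with s1(3) have valid: "valid_pair n w (ireg s1 8) (ireg s1 9)"
        by (simp add: searched_def)
      have "wp report (wp (block []) (wp (block []) Q)) (t1 + 1) s1"
      proof (rule wp_report[OF ready1], goal_cases)
        case (2 t2 s2)
        have "Q (t2 + 1 + 1) s2"
          by (rule Q) (use 2 valid t1 tape in \<open>auto simp del: upt_Suc\<close>)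
        then show ?case by simp
      qed (use valid in \<open>simp add: valid_pair_def\<close>)
      then show ?thesis
        using nonzero zero by simp
    qed
  qed (use assms(1) in simp)
  then show ?thesis
    using False assms(1) by (simp add: decide_def mult_2 numeral_eq_Suc)
qed

section \<open>From the coordinates in memory to the problem\<close>

lemma length_coords [simp]: "length (coords n v) = 2 * n"
  by (induction n) (simp_all add: coords_def)

lemma coords_nth:
  assumes "k < n"
  shows "coords n v ! (2 * k) = v (k + 1) $ 1" "coords n v ! Suc (2 * k) = v (k + 1) $ 2"
proof -
  have Suc: "coords (Suc n) v = coords n v @ [v (Suc n) $ 1, v (Suc n) $ 2]" for n
    by (simp add: coords_def)
  have "coords n v ! (2 * k) = v (k + 1) $ 1 \<and> coords n v ! Suc (2 * k) = v (k + 1) $ 2"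
    using assms by (induction n) (auto simp: Suc nth_append less_Suc_eq)
  then show "coords n v ! (2 * k) = v (k + 1) $ 1" "coords n v ! Suc (2 * k) = v (k + 1) $ 2"
    by auto
qed

text \<open>
  The numbering of the input vectors by their position in memory, with 0 for the blank cells behind them.
\<close>

definition inputs :: "nat \<Rightarrow> (nat \<Rightarrow> real^2) \<Rightarrow> (nat \<Rightarrow> real^2) \<Rightarrow> nat \<Rightarrow> real^2" where
  "inputs n e \<tau> k = (if k < n then e (k + 1) else if k < 2 * n then \<tau> (k - n + 1) else 0)"

lemma stored_inputs: "stored (inputs n e \<tau>) (initial n (coords n e @ coords n \<tau>))"
proof -
  have "(coords n e @ coords n \<tau>) ! (2 * k) = \<tau> (k - n + 1) $ 1"
    "(coords n e @ coords n \<tau>) ! Suc (2 * k) = \<tau> (k - n + 1) $ 2" if "n \<le> k" "k < 2 * n" for k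
    using that coords_nth[of "k - n" n \<tau>]
    by (simp_all add: nth_append diff_mult_distrib2 Suc_diff_le)
  then show ?thesis
    by (auto simp: stored_def initial_def inputs_def nth_append coords_nth)
qed

lemma valid_pair_inputs:
  "valid_pair n (inputs n e \<tau>) a b \<longleftrightarrow> witness_pair n e \<tau> (inputs n e \<tau> a) (inputs n e \<tau> b)"
proof -
  have "(\<forall>j\<in>{1..n}. P j) \<longleftrightarrow> (\<forall>j<n. P (j + 1))" for P
    unfolding image_Suc_lessThan[symmetric] by auto
  moreover have "inputs n e \<tau> j = e (j + 1)" "inputs n e \<tau> (n + j) = \<tau> (j + 1)" if "j < n" for j
    using that by (simp_all add: inputs_def)
  ultimately show ?thesis
    unfolding valid_pair_def witness_pair_def by auto
qed

lemma inputs_surj: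
  assumes "u \<in> e ` {1..n} \<union> \<tau> ` {1..n}"
  shows "\<exists>k<2 * n. inputs n e \<tau> k = u"
proof -
  from assms obtain j where j: "j \<in> {1..n}" "u = e j \<or> u = \<tau> j"
    by auto
  then have "inputs n e \<tau> (j - 1) = e j" "inputs n e \<tau> (n + (j - 1)) = \<tau> j"
    by (auto simp: inputs_def)
  with j show ?thesis
    by (intro exI[of _ "if u = e j then j - 1 else n + (j - 1)"]) auto
qed

theorem theorem2p1:
  shows "\<exists>(P :: com) (p :: nat poly). \<forall>(n :: nat) (e :: nat \<Rightarrow> real^2) (\<tau> :: nat \<Rightarrow> real^2).
    (\<forall>j\<in>{1..n}. e j \<noteq> 0) \<and> pairwise (\<lambda>i j. \<not> parallel (e i) (e j)) {1..n} \<and>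
    (\<forall>j\<in>{1..n}. \<tau> j \<noteq> 0) \<and> pairwise (\<lambda>i j. \<not> parallel (\<tau> i) (\<tau> j)) {1..n} \<longrightarrow>
    (\<exists>t s. run P (initial n (coords n e @ coords n \<tau>)) t s \<and> t \<le> poly p n \<and>
      ((\<exists>J js. J \<subseteq> {1..n} \<and> discrete (mixed_span e \<tau> n J) \<and>
          tape s = 1 # js \<and> set js = J) \<or>
       (\<not> (\<exists>J. J \<subseteq> {1..n} \<and> discrete (mixed_span e \<tau> n J)) \<and>
          tape s = [0])))"
proof -
  have correct: "\<exists>t s. run decide (initial n (coords n e @ coords n \<tau>)) t s \<and>
      t \<le> poly [:60, 60, 300, 400:] n \<and>
      ((\<exists>J js. J \<subseteq> {1..n} \<and> discrete (mixed_span e \<tau> n J) \<and>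
          tape s = 1 # js \<and> set js = J) \<or>
       (\<not> (\<exists>J. J \<subseteq> {1..n} \<and> discrete (mixed_span e \<tau> n J)) \<and>
          tape s = [0]))"
    if nonzero: "\<forall>j\<in>{1..n}. e j \<noteq> 0"
      and e: "pairwise (\<lambda>i j. \<not> parallel (e i) (e j)) {1..n}"
      and \<tau>: "pairwise (\<lambda>i j. \<not> parallel (\<tau> i) (\<tau> j)) {1..n}"
    for n :: nat and e \<tau> :: "nat \<Rightarrow> real^2"
  proof -
    let ?w = "inputs n e \<tau>"
    let ?answer = "\<lambda>s. (\<exists>J js. J \<subseteq> {1..n} \<and> discrete (mixed_span e \<tau> n J) \<and>
          tape s = 1 # js \<and> set js = J) \<or>
       (\<not> (\<exists>J. J \<subseteq> {1..n} \<and> discrete (mixed_span e \<tau> n J)) \<and> tape s = [0])"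
    have "wp decide (\<lambda>t s. t \<le> poly [:60, 60, 300, 400:] n \<and> ?answer s) 0
        (initial n (coords n e @ coords n \<tau>))"
    proof (rule wp_decide[OF _ stored_inputs])
      fix t :: nat and s :: state
      assume "t \<le> 0 + 400 * n ^ 3 + 300 * n ^ 2 + 60 * n + 60"
      then have time: "t \<le> poly [:60, 60, 300, 400:] n"
        by (simp add: power2_eq_square power3_eq_cube algebra_simps)
      assume "n < 2 \<and> tape s = [1] \<or>
        n \<ge> 2 \<and> tape s = [0] \<and> \<not> (\<exists>a<2 * n. \<exists>b<2 * n. valid_pair n ?w a b) \<or>
        (\<exists>a b. valid_pair n ?w a b \<and>
          tape s = 1 # filter (\<lambda>j. ?w (j - 1) \<notin> rat_span (?w a) (?w b)) [1..<Suc n])"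
      then consider (small) "n < 2" "tape s = [1]"
        | (no) "n \<ge> 2" "tape s = [0]" "\<not> (\<exists>a<2 * n. \<exists>b<2 * n. valid_pair n ?w a b)"
        | (yes) a b where "valid_pair n ?w a b"
            "tape s = 1 # filter (\<lambda>j. ?w (j - 1) \<notin> rat_span (?w a) (?w b)) [1..<Suc n]"
        by blast
      then have "?answer s"
      proof cases
        case small
        \<comment> \<open>For \<open>n = 0\<close> there is no generator, and any nonzero \<open>x\<close> will do.\<close>
        have "\<exists>x. x \<noteq> 0 \<and> e ` {1..n} \<subseteq> {x}"
        proof (cases "n = 0")
          case True
          then show ?thesis
            by (intro exI[of _ "axis 1 1"]) (simp add: axis_eq_0_iff)
        next
          case False
          with small(1) have "n = 1" by simp
          with nonzero show ?thesis by auto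
        qed
        then have "discrete (mixed_span e \<tau> n {})"
          unfolding mixed_span_def using discrete_group_closure_singleton by auto
        with small(2) show ?thesis by auto
      next
        case no
        have "\<not> discrete (mixed_span e \<tau> n J)" for J
        proof
          assume "discrete (mixed_span e \<tau> n J)"
          from witness_pair_if_discrete[OF no(1) this e \<tau>] inputs_surj
          obtain a b where "a < 2 * n" "b < 2 * n" "witness_pair n e \<tau> (?w a) (?w b)"
            by metis
          with no(3) show False
            by (auto simp: valid_pair_inputs)
        qed
        with no(2) show ?thesis by blast
      next
        case yes
        let ?J = "{j\<in>{1..n}. e j \<notin> rat_span (?w a) (?w b)}"
        have "discrete (mixed_span e \<tau> n ?J)"
          using yes(1) by (intro discrete_if_witness_pair) (simp add: valid_pair_inputs)
        moreover have "set (filter (\<lambda>j. ?w (j - 1) \<notin> rat_span (?w a) (?w b)) [1..<Suc n]) = ?J"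
        proof -
          have "?w (j - 1) = e j" if "j \<in> {1..n}" for j
            using that by (auto simp: inputs_def)
          moreover have "set [1..<Suc n] = {1..n}"
            by auto
          ultimately show ?thesis
            unfolding set_filter by auto
        qed
        moreover have "?J \<subseteq> {1..n}"
          by blast
        ultimately show ?thesis
          using yes(2) by blast
      qed
      with time show "t \<le> poly [:60, 60, 300, 400:] n \<and> ?answer s"
        by blast
    qed (simp_all add: initial_def)
    then show ?thesis
      by (simp add: wp_def)
  qed
  show ?thesis
    by (intro exI[of _ decide] exI[of _ "[:60, 60, 300, 400:]"] allI impI) (elim conjE, rule correct)
qed

end
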